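(* For every positive integer $k$, $$\int_{\mathbb{R}}\mathbb{E}_{Q\sim\mathrm{GOE}(k)}\left[\det(Q-u\mathbb{1})^2\right]e^{-u^2}\,du=\sqrt{\pi}\,\frac{(k+2)!}{2^{k+1}}.$$
   Context: $\mathrm{GOE}(k)$ is the probability measure on the space $\mathrm{Sym}(k,\mathbb{R})$ of real symmetric $k\times k$ matrices (dimension $K=\frac{k(k+1)}2$) with density $\frac{1}{\sqrt2^{\,k}\sqrt\pi^{\,K}}e^{-\mathrm{tr}(A^2)/2}$ with respect to the Lebesgue measure $dA=\prod_{1\le i\le j\le k}dA_{ij}$; equivalently the diagonal entries are $N(0,1)$, the entries above the diagonal are $N(0,\tfrac12)$, all independent. $\mathbb{1}$ is the identity matrix. *)

theory Defs
  imports "HOL-Probability.Probability" "Jordan_Normal_Form.Determinant"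
begin

text \<open>Index set of the free coordinates of a real symmetric k x k matrix:
  pairs (i,j) with i \<le> j < k (K = k(k+1)/2 of them).\<close>
definition sym_idx :: "nat \<Rightarrow> (nat \<times> nat) set" where
  "sym_idx k = {(i, j). i \<le> j \<and> j < k}"

definition sym_of :: "nat \<Rightarrow> (nat \<times> nat \<Rightarrow> real) \<Rightarrow> real mat" where
  "sym_of k x = mat k k (\<lambda>(i, j). if i \<le> j then x (i, j) else x (j, i))"

definition mat_trace :: "real mat \<Rightarrow> real" where
  "mat_trace A = (\<Sum>i<dim_row A. A $$ (i, i))"

definition goe_density :: "nat \<Rightarrow> (nat \<times> nat \<Rightarrow> real) \<Rightarrow> real" where
  "goe_density k x =
     exp (- mat_trace (sym_of k x * sym_of k x) / 2)
       / (sqrt 2 ^ k * sqrt pi ^ (k * (k + 1) div 2))"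

definition GOE :: "nat \<Rightarrow> (nat \<times> nat \<Rightarrow> real) measure" where
  "GOE k = density (PiM (sym_idx k) (\<lambda>_. lborel)) (\<lambda>x. ennreal (goe_density k x))"

end

theory Submission
  imports Defs "Jordan_Normal_Form.Char_Poly"
begin

text \<open>
  Let \<open>p\<close> be the characteristic polynomial of \<open>Q\<close> and \<open>K\<^sub>k(u, v)\<close> the expectation of
  \<open>p(u) p(v)\<close>; separating the two arguments is what makes the following recursion close.
  Expand the determinant of size \<open>k + 1\<close> along its last row and column and average over them
  by Wick's formula. With the adjugate \<open>A\<^sub>u\<close> of \<open>u - Q\<close>, the traces that appear are
  \<open>tr A\<^sub>u = p'(u)\<close> and, by the resolvent identity,
  \<open>(u - v) tr (A\<^sub>u A\<^sub>v) = p(u) p'(v) - p(v) p'(u)\<close>. Hence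
  \<open>K\<^sub>k\<^sub>+\<^sub>1 = K\<^sub>k + (u - \<partial>\<^sub>u/2) (v - \<partial>\<^sub>v/2) K\<^sub>k + (\<partial>\<^sub>v - \<partial>\<^sub>u) K\<^sub>k / (2 (u - v))\<close>.
  For the monic Hermite polynomials \<open>h\<^sub>j\<close> of the weight \<open>exp (- u\<^sup>2)\<close>, with squared norms
  \<open>sqrt pi * c\<^sub>j\<close>, the first operator raises \<open>h\<^sub>j(u) h\<^sub>j(v)\<close> and the second one is a
  Christoffel-Darboux kernel, so \<open>K\<^sub>k\<close> stays diagonal:
  \<open>K\<^sub>k = k!/2^k * (\<Sum>j\<le>k. (k + 1 - j) h\<^sub>j(u) h\<^sub>j(v) / c\<^sub>j)\<close>. Integrating the diagonal
  gives \<open>sqrt pi * k!/2^k * (\<Sum>j\<le>k. k + 1 - j)\<close>.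
\<close>

hide_const (open) Module.smult

section \<open>Monic Hermite polynomials\<close>

text \<open>These are the physicists' Hermite polynomials divided by \<open>2 ^ n\<close>. The
  recursion is the raising operator that also acts on each argument of the correlation
  kernel.\<close>

fun hermite :: "nat \<Rightarrow> real poly" where
  "hermite 0 = 1"
| "hermite (Suc n) = [:0, 1:] * hermite n - smult (1/2) (pderiv (hermite n))"

text \<open>The squared norm for the weight \<open>exp (- u\<^sup>2)\<close>, divided by \<open>sqrt pi\<close>.\<close>

definition hermite_norm :: "nat \<Rightarrow> real" where
  "hermite_norm n = fact n / 2 ^ n"

lemma hermite_norm_pos: "hermite_norm n > 0"
  by (simp add: hermite_norm_def)

lemma hermite_norm_nonzero [simp]: "hermite_norm n \<noteq> 0"
  using hermite_norm_pos[of n] by simp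

lemma hermite_norm_Suc: "hermite_norm (Suc n) = real (Suc n) / 2 * hermite_norm n"
  by (simp add: hermite_norm_def)

text \<open>Differentiation commutes with the raising operator up to the identity, so each step of
  the induction contributes one more copy of \<open>hermite (Suc n)\<close>.\<close>

lemma pderiv_hermite_Suc: "pderiv (hermite (Suc n)) = smult (real (Suc n)) (hermite n)"
proof (induction n)
  case 0
  then show ?case by (simp add: pderiv_mult pderiv_pCons)
next
  case (Suc n)
  have "pderiv (hermite (Suc (Suc n)))
      = hermite (Suc n) + [:0, 1:] * smult (real (Suc n)) (hermite n)
        - smult (1/2) (pderiv (smult (real (Suc n)) (hermite n)))"
    unfolding hermite.simps(2)[of "Suc n"] pderiv_diff pderiv_mult pderiv_smult Suc
    by (simp add: pderiv_pCons)
  also have "\<dots> = hermite (Suc n) + smult (real (Suc n)) (hermite (Suc n))"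
    by (simp add: pderiv_smult smult_diff_right)
  also have "\<dots> = smult (1 + real (Suc n)) (hermite (Suc n))"
    by (simp only: smult_add_left smult_1_left)
  finally show ?case
    by (simp del: hermite.simps)
qed

lemma hermite_Suc_Suc:
  "hermite (Suc (Suc n)) = [:0, 1:] * hermite (Suc n) - smult (real (Suc n) / 2) (hermite n)"
  by (subst hermite.simps(2)) (simp only: pderiv_hermite_Suc smult_smult, simp)

text \<open>The three-term recurrence peels off the top summand and leaves the same expression one
  index lower. Keeping the factor \<open>u - v\<close> on the right makes the identity valid on the
  diagonal as well.\<close>

lemma hermite_Christoffel_Darboux:
  "poly (hermite (Suc n)) u * poly (hermite n) v - poly (hermite (Suc n)) v * poly (hermite n) u
    = (u - v) * (\<Sum>j\<le>n. hermite_norm n / hermite_norm j * (poly (hermite j) u * poly (hermite j) v))"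
proof (induction n)
  case 0
  then show ?case by (simp add: hermite_norm_def)
next
  case (Suc n)
  let ?h = "\<lambda>n x. poly (hermite n) x"
  have rec: "?h (Suc (Suc n)) x = x * ?h (Suc n) x - real (Suc n) / 2 * ?h n x" for x
    by (simp only: hermite_Suc_Suc poly_diff poly_mult poly_smult) simp
  have "?h (Suc (Suc n)) u * ?h (Suc n) v - ?h (Suc (Suc n)) v * ?h (Suc n) u
     = (u - v) * (?h (Suc n) u * ?h (Suc n) v)
       + real (Suc n) / 2 * (?h (Suc n) u * ?h n v - ?h (Suc n) v * ?h n u)"
    unfolding rec by (simp add: algebra_simps del: hermite.simps)
  also have "\<dots> = (u - v) * (?h (Suc n) u * ?h (Suc n) v) + (u - v) * (\<Sum>j\<le>n. hermite_norm (Suc n) / hermite_norm j * (?h j u * ?h j v))"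
    unfolding Suc hermite_norm_Suc by (simp add: sum_distrib_left mult_ac del: hermite.simps of_nat_Suc)
  finally show ?case
    using hermite_norm_pos[of "Suc n"] by (simp add: algebra_simps del: hermite.simps)
qed

text \<open>Since the derivative lowers the index, this is Christoffel-Darboux at index
  \<open>n - 1\<close>; the 2 comes from the ratio of consecutive norms. It evaluates the resolvent
  term of the recursion on a product of Hermite polynomials.\<close>

lemma hermite_wronskian:
  "poly (hermite n) u * poly (pderiv (hermite n)) v - poly (hermite n) v * poly (pderiv (hermite n)) u
    = 2 * (u - v) * (\<Sum>j<n. hermite_norm n / hermite_norm j * (poly (hermite j) u * poly (hermite j) v))"
proof (cases n)
  case 0
  then show ?thesis by simp
next
  case (Suc m)
  have "poly (hermite n) u * poly (pderiv (hermite n)) v - poly (hermite n) v * poly (pderiv (hermite n)) u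
    = real (Suc m) * (poly (hermite (Suc m)) u * poly (hermite m) v - poly (hermite (Suc m)) v * poly (hermite m) u)"
    unfolding Suc pderiv_hermite_Suc by (simp add: algebra_simps del: hermite.simps)
  also have "\<dots> = 2 * (u - v) * (\<Sum>j\<le>m. hermite_norm n / hermite_norm j * (poly (hermite j) u * poly (hermite j) v))"
    unfolding hermite_Christoffel_Darboux Suc hermite_norm_Suc sum_distrib_left
    by (intro sum.cong refl) (simp add: field_simps del: hermite.simps)
  finally show ?thesis unfolding Suc lessThan_Suc_atMost .
qed

section \<open>Integrals of polynomials against the Gaussian weight\<close>

lemma normal_density_half: "normal_density 0 (1 / sqrt 2) x = exp (- x\<^sup>2) / sqrt pi"
  by (simp add: normal_density_def power_divide)

definition gauss_functional :: "real poly \<Rightarrow> real" where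
  "gauss_functional p = (\<integral>x. poly p x * exp (- x\<^sup>2) \<partial>lborel)"

lemma integrable_monomial_gauss: "integrable lborel (\<lambda>x::real. x ^ n * exp (- x\<^sup>2))"
proof -
  have "integrable lborel (\<lambda>x. sqrt pi * (normal_density 0 (1 / sqrt 2) x * (x - 0) ^ n))"
    by (intro integrable_mult_right integrable_normal_moment) simp
  then show ?thesis
    unfolding normal_density_half by (simp add: mult_ac)
qed

lemma integrable_poly_gauss: "integrable lborel (\<lambda>x::real. poly p x * exp (- x\<^sup>2))"
  unfolding poly_altdef sum_distrib_right mult.assoc
  by (intro Bochner_Integration.integrable_sum integrable_mult_right integrable_monomial_gauss)

lemma gauss_functional_add: "gauss_functional (p + q) = gauss_functional p + gauss_functional q"
  unfolding gauss_functional_def poly_add ring_distribs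
  by (intro Bochner_Integration.integral_add integrable_poly_gauss)

lemma gauss_functional_smult: "gauss_functional (smult c p) = c * gauss_functional p"
  unfolding gauss_functional_def poly_smult mult.assoc by (rule integral_mult_right_zero)

lemma gauss_functional_monom_even:
  "gauss_functional (monom 1 (2 * n)) = sqrt pi * fact (2 * n) / (4 ^ n * fact n)"
proof -
  have "gauss_functional (monom 1 (2 * n)) = (\<integral>x. sqrt pi * (normal_density 0 (1 / sqrt 2) x * (x - 0) ^ (2 * n)) \<partial>lborel)"
    unfolding gauss_functional_def normal_density_half by (simp add: poly_monom mult_ac)
  also have "\<dots> = sqrt pi * (fact (2 * n) / ((2 / (1 / sqrt 2)\<^sup>2) ^ n * fact n))"
    unfolding integral_mult_right_zero by (subst integral_normal_moment_even) simp_all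
  finally show ?thesis by (simp add: power_divide)
qed

lemma gauss_functional_monom_odd: "gauss_functional (monom 1 (2 * n + 1)) = 0"
proof -
  have "gauss_functional (monom 1 (2 * n + 1)) = (\<integral>x. sqrt pi * (normal_density 0 (1 / sqrt 2) x * (x - 0) ^ (2 * n + 1)) \<partial>lborel)"
    unfolding gauss_functional_def normal_density_half by (simp add: poly_monom mult_ac)
  also have "\<dots> = sqrt pi * 0"
    unfolding integral_mult_right_zero by (subst integral_normal_moment_odd) simp_all
  finally show ?thesis by simp
qed

text \<open>Integration by parts is read off from the explicit moments, so no boundary terms have to
  be estimated.\<close>

lemma gauss_functional_by_parts_monom:
  "gauss_functional (pderiv (monom 1 n)) = 2 * gauss_functional ([:0, 1:] * monom 1 n)"
proof -
  have X: "[:0, 1:] * monom 1 n = monom (1::real) (Suc n)"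
    by (simp add: monom_Suc)
  have D: "pderiv (monom (1::real) n) = smult (real n) (monom 1 (n - 1))"
    by (simp add: pderiv_monom smult_monom)
  show ?thesis
  proof (cases "odd n")
    case False
    then obtain m where n: "n = 2 * m" by blast
    have "gauss_functional (monom 1 (Suc n)) = 0"
      using gauss_functional_monom_odd[of m] n by simp
    \<comment> \<open>For \<open>n = 0\<close> the subtraction truncates, and it is the factor
      \<open>real n\<close> that vanishes; otherwise \<open>n - 1\<close> is odd.\<close>
    moreover have "real n * gauss_functional (monom 1 (n - 1)) = 0"
      using gauss_functional_monom_odd[of "m - 1"] n by (cases m) simp_all
    ultimately show ?thesis unfolding X D gauss_functional_smult by simp
  next
    case True
    then obtain m where n: "n = 2 * m + 1" by (elim oddE)
    have S: "Suc n = 2 * Suc m" "n - 1 = 2 * m" using n by simp_all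
    have f: "fact (2 * Suc m) = (2 * real m + 2) * (2 * real m + 1) * fact (2 * m)"
      by (simp add: algebra_simps)
    show ?thesis
      unfolding X D gauss_functional_smult S gauss_functional_monom_even f
      by (simp add: n divide_simps) (simp add: algebra_simps)
  qed
qed

lemma gauss_functional_by_parts: "gauss_functional (pderiv p) = 2 * gauss_functional ([:0, 1:] * p)"
proof -
  have step: "gauss_functional (pderiv (monom a n)) = 2 * gauss_functional ([:0, 1:] * monom a n)" for a n
  proof -
    have "monom a n = smult a (monom 1 n)" by (simp add: smult_monom)
    then show ?thesis
      by (simp only: pderiv_smult mult_smult_right gauss_functional_smult gauss_functional_by_parts_monom)
  qed
  have "gauss_functional (pderiv (\<Sum>i\<le>n. monom (coeff p i) i))
      = 2 * gauss_functional ([:0, 1:] * (\<Sum>i\<le>n. monom (coeff p i) i))" for n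
    by (induction n)
       (simp_all only: sum.atMost_Suc atMost_0 sum.insert sum.empty finite.emptyI empty_iff not_False_eq_True
         add_0_right step pderiv_add distrib_left gauss_functional_add)
  then show ?thesis
    by (metis poly_as_sum_of_monoms)
qed

text \<open>Write one factor as a raised polynomial and trade multiplication by the variable for
  half a derivative. The terms with \<open>pderiv (hermite n)\<close> cancel, and the norm grows by
  the factor \<open>(n + 1) / 2\<close>.\<close>

lemma gauss_functional_hermite_square:
  "gauss_functional (hermite n * hermite n) = sqrt pi * hermite_norm n"
proof (induction n)
  case 0
  show ?case
    using gauss_functional_monom_even[of 0] by (simp add: hermite_norm_def monom_0 one_pCons)
next
  case (Suc n)
  let ?f = "hermite (Suc n)" and ?g = "hermite n"
  have "?f * ?f = [:0, 1:] * (?f * ?g) + smult (-1/2) (?f * pderiv ?g)"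
    by (subst (2) hermite.simps(2)) (simp add: algebra_simps del: hermite.simps)
  then have "gauss_functional (?f * ?f)
      = gauss_functional ([:0, 1:] * (?f * ?g)) - 1/2 * gauss_functional (?f * pderiv ?g)"
    by (simp only: gauss_functional_add gauss_functional_smult)
  also have "gauss_functional ([:0, 1:] * (?f * ?g)) = 1/2 * gauss_functional (pderiv (?f * ?g))"
    by (simp only: gauss_functional_by_parts)
  also have "pderiv (?f * ?g) = ?f * pderiv ?g + smult (real (Suc n)) (?g * ?g)"
    by (simp only: pderiv_mult pderiv_hermite_Suc mult_smult_right)
  finally show ?case
    by (simp add: gauss_functional_add gauss_functional_smult Suc hermite_norm_Suc algebra_simps del: hermite.simps)
qed

section \<open>Bordered determinants and adjugates\<close>

lemma mat_delete_last:
  assumes B: "B \<in> carrier_mat (Suc n) (Suc n)"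
  shows "mat_delete B n n = mat n n (\<lambda>(i, j). B $$ (i, j))"
  using B by (auto simp: mat_delete_def)

text \<open>Laplace expansion along the last row, then along the last column of each minor. The
  border enters only through the corner and a bilinear form in the cofactors of the inner block,
  ready for averaging.\<close>

lemma det_bordered:
  fixes B :: "'a :: comm_ring_1 mat"
  assumes B: "B \<in> carrier_mat (Suc n) (Suc n)"
  defines "M \<equiv> mat n n (\<lambda>(i, j). B $$ (i, j))"
  shows "det B = B $$ (n, n) * det M
      - (\<Sum>i<n. \<Sum>j<n. B $$ (i, n) * B $$ (n, j) * cofactor M i j)"
proof -
  have minor: "cofactor B n j = - (\<Sum>i<n. B $$ (i, n) * cofactor M i j)" if j: "j < n" for j
  proof -
    let ?D = "mat_delete B n j"
    obtain m where n: "n = Suc m" using j by (cases n) auto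
    have D: "?D \<in> carrier_mat n n" using mat_delete_carrier[OF B] by simp
    \<comment> \<open>Deleting column \<open>j < n\<close> shifts the last column of
      \<open>B\<close> to position \<open>m = n - 1\<close>.\<close>
    have entry: "?D $$ (i, m) = B $$ (i, n)" if "i < n" for i
      using that j B n by (auto simp: mat_delete_def)
    have del: "mat_delete ?D i m = mat_delete M i j" if "i < n" for i
      using that j B n by (intro eq_matI) (auto simp: mat_delete_def M_def)
    have "det ?D = (\<Sum>i<n. ?D $$ (i, m) * cofactor ?D i m)"
      by (rule laplace_expansion_column[OF D]) (simp add: n)
    also have "\<dots> = (\<Sum>i<n. B $$ (i, n) * ((-1) ^ (i + m) * det (mat_delete M i j)))"
      unfolding cofactor_def by (intro sum.cong refl) (simp add: entry del)
    finally have "cofactor B n j = (\<Sum>i<n. (-1) ^ (n + j) * (B $$ (i, n) * ((-1) ^ (i + m) * det (mat_delete M i j))))"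
      unfolding cofactor_def by (simp add: sum_distrib_left)
    also have "\<dots> = (\<Sum>i<n. - (B $$ (i, n) * cofactor M i j))"
    proof (intro sum.cong refl)
      fix i
      \<comment> \<open>Because \<open>n = m + 1\<close>, the exponents add up to
        \<open>i + j\<close> plus an odd number; this is the source of the minus sign in the
        formula.\<close>
      have sgn: "(-1::'a) ^ (n + j) * (-1) ^ (i + m) = - ((-1) ^ (i + j))"
        unfolding n power_add by (simp add: mult_ac left_minus_one_mult_self)
      have "(-1) ^ (n + j) * (B $$ (i, n) * ((-1) ^ (i + m) * det (mat_delete M i j)))
          = ((-1) ^ (n + j) * (-1) ^ (i + m)) * (B $$ (i, n) * det (mat_delete M i j))"
        by (simp only: mult.assoc mult.left_commute)
      then show "(-1) ^ (n + j) * (B $$ (i, n) * ((-1) ^ (i + m) * det (mat_delete M i j)))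
          = - (B $$ (i, n) * cofactor M i j)"
        unfolding sgn cofactor_def by (simp only: mult.left_commute mult_minus_left mult_minus_right)
    qed
    finally show ?thesis by (simp add: sum_negf)
  qed
  have last: "cofactor B n n = det M"
    unfolding cofactor_def mat_delete_last[OF B] M_def by simp
  have "det B = (\<Sum>j<Suc n. B $$ (n, j) * cofactor B n j)"
    by (rule laplace_expansion_row[OF B]) simp
  also have "\<dots> = B $$ (n, n) * det M + (\<Sum>j<n. B $$ (n, j) * - (\<Sum>i<n. B $$ (i, n) * cofactor M i j))"
    by (simp add: minor last)
  also have "(\<Sum>j<n. B $$ (n, j) * - (\<Sum>i<n. B $$ (i, n) * cofactor M i j))
      = - (\<Sum>j<n. \<Sum>i<n. B $$ (i, n) * B $$ (n, j) * cofactor M i j)"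
    by (simp add: sum_negf sum_distrib_left mult_ac)
  also have "(\<Sum>j<n. \<Sum>i<n. B $$ (i, n) * B $$ (n, j) * cofactor M i j)
      = (\<Sum>i<n. \<Sum>j<n. B $$ (i, n) * B $$ (n, j) * cofactor M i j)"
    by (rule sum.swap)
  finally show ?thesis by simp
qed

text \<open>Needed to identify the two crossed Wick pairings, which differ by a transposition of one
  cofactor matrix.\<close>

lemma cofactor_symmetric:
  assumes A: "A \<in> carrier_mat n n" and sym: "A\<^sup>T = A" and ij: "i < n" "j < n"
  shows "cofactor A i j = cofactor A j i"
proof -
  have s: "A $$ (a, b) = A $$ (b, a)" if "a < n" "b < n" for a b
    using that A sym by (metis carrier_matD index_transpose_mat(1))
  have "(mat_delete A i j)\<^sup>T = mat_delete A j i"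
    using A ij by (intro eq_matI) (auto simp: mat_delete_def intro!: s)
  then have "det (mat_delete A j i) = det (mat_delete A i j)"
    using det_transpose[OF mat_delete_carrier[OF A]] by metis
  then show ?thesis unfolding cofactor_def by (simp add: add.commute)
qed

section \<open>Characteristic polynomials, traces of adjugates and the resolvent identity\<close>

lemma poly_char_poly:
  fixes A :: "real mat"
  assumes A: "A \<in> carrier_mat n n"
  shows "poly (char_poly A) u = det (u \<cdot>\<^sub>m 1\<^sub>m n - A)"
proof -
  have "- char_matrix A u = u \<cdot>\<^sub>m 1\<^sub>m n - A"
    using A by (intro eq_matI) (auto simp: char_matrix_def)
  then show ?thesis using char_poly_matrix[OF A] by simp
qed

text \<open>Jacobi's formula: the derivative is the sum of the characteristic polynomials of the
  principal submatrices, and these are the diagonal cofactors of the shifted matrix.\<close>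

lemma poly_pderiv_char_poly:
  fixes A :: "real mat"
  assumes A: "A \<in> carrier_mat n n"
  shows "poly (pderiv (char_poly A)) u = (\<Sum>i<n. cofactor (u \<cdot>\<^sub>m 1\<^sub>m n - A) i i)"
proof -
  have "poly (char_poly (mat_delete A i i)) u = cofactor (u \<cdot>\<^sub>m 1\<^sub>m n - A) i i" if i: "i < n" for i
  proof -
    have "u \<cdot>\<^sub>m 1\<^sub>m (n - 1) - mat_delete A i i = mat_delete (u \<cdot>\<^sub>m 1\<^sub>m n - A) i i"
      using A i by (intro eq_matI) (auto simp: mat_delete_def)
    then show ?thesis
      unfolding poly_char_poly[OF mat_delete_carrier[OF A]] cofactor_def by simp
  qed
  then show ?thesis
    unfolding pderiv_char_poly[OF A] poly_sum by (intro sum.cong) auto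
qed

text \<open>Resolvent identity, multiplied through by both determinants so that it needs no invertibility.\<close>

lemma cofactor_resolvent:
  fixes A :: "real mat"
  assumes A: "A \<in> carrier_mat n n"
  defines "M \<equiv> \<lambda>u. u \<cdot>\<^sub>m 1\<^sub>m n - A"
  shows "(u - v) * (\<Sum>i<n. \<Sum>j<n. cofactor (M u) i j * cofactor (M v) j i)
      = det (M u) * (\<Sum>i<n. cofactor (M v) i i) - det (M v) * (\<Sum>i<n. cofactor (M u) i i)"
proof -
  have M: "M u \<in> carrier_mat n n" for u using A by (auto simp: M_def)
  note adj = adj_mat[OF M]
  let ?A = "\<lambda>u. adj_mat (M u)"
  \<comment> \<open>The difference is sandwiched between the two adjugates, each of which turns its
    own matrix into a determinant. As the difference is also \<open>u - v\<close> times the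
    identity, taking traces gives the claim.\<close>
  have "?A u * (M u - M v) * ?A v = det (M u) \<cdot>\<^sub>m ?A v - det (M v) \<cdot>\<^sub>m ?A u"
  proof -
    have "?A u * (M u - M v) * ?A v = ?A u * M u * ?A v - ?A u * M v * ?A v"
      using M adj(1)[of u] adj(1)[of v]
      by (simp add: mult_minus_distrib_mat[of _ n n _ n] minus_mult_distrib_mat[of _ n n _ _ n])
    also have "?A u * M v * ?A v = ?A u * (M v * ?A v)"
      using M adj(1)[of u] adj(1)[of v] by (simp add: assoc_mult_mat[of _ n n _ n _ n])
    also have "\<dots> = det (M v) \<cdot>\<^sub>m ?A u"
      unfolding adj(2) using adj(1)[of u] by (simp add: mult_smult_distrib[of _ n n _ n])
    also have "?A u * M u * ?A v = det (M u) \<cdot>\<^sub>m ?A v"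
      unfolding adj(3) using adj(1)[of v] by (simp add: mult_smult_assoc_mat[of _ n n _ n])
    finally show ?thesis .
  qed
  moreover have "M u - M v = (u - v) \<cdot>\<^sub>m 1\<^sub>m n"
    using A by (intro eq_matI) (auto simp: M_def algebra_simps)
  ultimately have eq: "(u - v) \<cdot>\<^sub>m (?A u * ?A v) = det (M u) \<cdot>\<^sub>m ?A v - det (M v) \<cdot>\<^sub>m ?A u"
    using adj(1)[of u] adj(1)[of v]
    by (simp add: mult_smult_distrib[of _ n n _ n] mult_smult_assoc_mat[of _ n n _ n])
  have entry: "?A w $$ (i, j) = cofactor (M w) j i" if "i < n" "j < n" for w i j
    using that M[of w] by (simp add: adj_mat_def)
  have "(u - v) * (\<Sum>j<n. cofactor (M u) j i * cofactor (M v) i j)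
      = det (M u) * cofactor (M v) i i - det (M v) * cofactor (M u) i i" if i: "i < n" for i
  proof -
    have "(?A u * ?A v) $$ (i, i) = (\<Sum>j<n. cofactor (M u) j i * cofactor (M v) i j)"
      using i adj(1)[of u] adj(1)[of v]
      by (simp add: scalar_prod_def entry lessThan_atLeast0)
    then show ?thesis
      using arg_cong[OF eq, of "\<lambda>X. X $$ (i, i)"] i adj(1)[of u] adj(1)[of v]
      by (simp add: entry)
  qed
  then have "(\<Sum>i<n. (u - v) * (\<Sum>j<n. cofactor (M u) j i * cofactor (M v) i j))
      = (\<Sum>i<n. det (M u) * cofactor (M v) i i - det (M v) * cofactor (M u) i i)"
    by (intro sum.cong) auto
  then show ?thesis
    by (subst sum.swap) (simp add: sum_distrib_left sum_subtractf)
qed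

section \<open>Functions with finite moments of all orders\<close>

text \<open>Over a finite measure this class is an algebra, so integrability of any polynomial in
  the matrix entries follows from that of the entries alone.\<close>

definition all_moments :: "'a measure \<Rightarrow> ('a \<Rightarrow> real) \<Rightarrow> bool" where
  "all_moments M f \<longleftrightarrow> f \<in> borel_measurable M \<and> (\<forall>n. integrable M (\<lambda>x. \<bar>f x\<bar> ^ n))"

lemma all_moments_measurable: "all_moments M f \<Longrightarrow> f \<in> borel_measurable M"
  by (simp add: all_moments_def)

lemma all_moments_integrable:
  assumes "all_moments M f"
  shows "integrable M f"
proof -
  have "integrable M (\<lambda>x. \<bar>f x\<bar> ^ 1)" using assms unfolding all_moments_def by blast
  then show ?thesis
    using all_moments_measurable[OF assms] by (simp add: integrable_abs_iff)
qed

lemma all_moments_const: "finite_measure M \<Longrightarrow> all_moments M (\<lambda>_. c)"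
  by (simp add: all_moments_def finite_measure.integrable_const)

lemma all_moments_add:
  assumes f: "all_moments M f" and g: "all_moments M g"
  shows "all_moments M (\<lambda>x. f x + g x)"
  unfolding all_moments_def
proof (intro conjI allI)
  note [measurable] = all_moments_measurable[OF f] all_moments_measurable[OF g]
  show "(\<lambda>x. f x + g x) \<in> borel_measurable M" by measurable
  fix n
  have bound: "\<bar>a + b\<bar> ^ n \<le> 2 ^ n * (\<bar>a\<bar> ^ n + \<bar>b\<bar> ^ n)" for a b :: real
  proof -
    have "\<bar>a + b\<bar> ^ n \<le> (2 * max \<bar>a\<bar> \<bar>b\<bar>) ^ n" by (intro power_mono) auto
    also have "\<dots> \<le> 2 ^ n * (\<bar>a\<bar> ^ n + \<bar>b\<bar> ^ n)"
      unfolding power_mult_distrib by (intro mult_left_mono) (auto simp: max_def)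
    finally show ?thesis .
  qed
  have int: "integrable M (\<lambda>x. 2 ^ n * (\<bar>f x\<bar> ^ n + \<bar>g x\<bar> ^ n))"
    using f g unfolding all_moments_def
    by (intro integrable_mult_right Bochner_Integration.integrable_add) blast+
  show "integrable M (\<lambda>x. \<bar>f x + g x\<bar> ^ n)"
  proof (rule Bochner_Integration.integrable_bound[OF int])
    show "AE x in M. norm (\<bar>f x + g x\<bar> ^ n) \<le> norm (2 ^ n * (\<bar>f x\<bar> ^ n + \<bar>g x\<bar> ^ n))"
      by (rule AE_I2, unfold real_norm_def, rule order_trans[OF _ abs_ge_self]) (simp only: bound power_abs abs_idempotent)
  qed measurable
qed

text \<open>Bounding a product by a sum of squares doubles the exponent, which is harmless when
  moments of every order are available.\<close>

lemma all_moments_mult: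
  assumes f: "all_moments M f" and g: "all_moments M g"
  shows "all_moments M (\<lambda>x. f x * g x)"
  unfolding all_moments_def
proof (intro conjI allI)
  note [measurable] = all_moments_measurable[OF f] all_moments_measurable[OF g]
  show "(\<lambda>x. f x * g x) \<in> borel_measurable M" by measurable
  fix n
  have bound: "\<bar>a * b\<bar> ^ n \<le> \<bar>a\<bar> ^ (2 * n) + \<bar>b\<bar> ^ (2 * n)" for a b :: real
  proof -
    have "2 * (\<bar>a\<bar> ^ n) * (\<bar>b\<bar> ^ n) \<le> (\<bar>a\<bar> ^ n)\<^sup>2 + (\<bar>b\<bar> ^ n)\<^sup>2"
      by (rule sum_squares_bound)
    moreover have "0 \<le> \<bar>a\<bar> ^ n * \<bar>b\<bar> ^ n" by simp
    ultimately show ?thesis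
      unfolding abs_mult power_mult_distrib power_even_eq by linarith
  qed
  have int: "integrable M (\<lambda>x. \<bar>f x\<bar> ^ (2 * n) + \<bar>g x\<bar> ^ (2 * n))"
    using f g unfolding all_moments_def
    by (intro Bochner_Integration.integrable_add) blast+
  show "integrable M (\<lambda>x. \<bar>f x * g x\<bar> ^ n)"
  proof (rule Bochner_Integration.integrable_bound[OF int])
    show "AE x in M. norm (\<bar>f x * g x\<bar> ^ n) \<le> norm (\<bar>f x\<bar> ^ (2 * n) + \<bar>g x\<bar> ^ (2 * n))"
      by (rule AE_I2, unfold real_norm_def, rule order_trans[OF _ abs_ge_self])
         (simp only: bound power_abs abs_idempotent)
  qed measurable
qed

lemma all_moments_sum:
  assumes "finite_measure M" "\<And>i. i \<in> I \<Longrightarrow> all_moments M (f i)"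
  shows "all_moments M (\<lambda>x. \<Sum>i\<in>I. f i x)"
  using assms(2) by (induction I rule: infinite_finite_induct)
    (auto intro: all_moments_add all_moments_const[OF assms(1)])

text \<open>A random polynomial is controlled through its coefficients, so that expectations can be
  taken coefficientwise and the argument stays free for differentiation.\<close>

definition coeff_moments :: "'a measure \<Rightarrow> ('a \<Rightarrow> real poly) \<Rightarrow> bool" where
  "coeff_moments M P \<longleftrightarrow> (\<forall>n. all_moments M (\<lambda>x. coeff (P x) n))"

lemma coeff_moments_const: "finite_measure M \<Longrightarrow> coeff_moments M (\<lambda>_. p)"
  by (simp add: coeff_moments_def all_moments_const)

lemma coeff_moments_add:
  "coeff_moments M P \<Longrightarrow> coeff_moments M Q \<Longrightarrow> coeff_moments M (\<lambda>x. P x + Q x)"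
  by (simp add: coeff_moments_def all_moments_add)

lemma coeff_moments_mult:
  assumes "finite_measure M" "coeff_moments M P" "coeff_moments M Q"
  shows "coeff_moments M (\<lambda>x. P x * Q x)"
  using assms unfolding coeff_moments_def coeff_mult
  by (auto intro!: all_moments_sum all_moments_mult)

lemma coeff_moments_pderiv:
  assumes "finite_measure M" "coeff_moments M P"
  shows "coeff_moments M (\<lambda>x. pderiv (P x))"
  using assms unfolding coeff_moments_def coeff_pderiv
  by (auto intro!: all_moments_mult all_moments_const simp del: of_nat_Suc)

lemma coeff_moments_sum:
  assumes "finite_measure M" "\<And>i. i \<in> I \<Longrightarrow> coeff_moments M (P i)"
  shows "coeff_moments M (\<lambda>x. \<Sum>i\<in>I. P i x)"
  using assms(2) by (induction I rule: infinite_finite_induct)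
    (auto intro: coeff_moments_add coeff_moments_const[OF assms(1)])

lemma coeff_moments_prod:
  assumes "finite_measure M" "\<And>i. i \<in> I \<Longrightarrow> coeff_moments M (P i)"
  shows "coeff_moments M (\<lambda>x. \<Prod>i\<in>I. P i x)"
  using assms(2) by (induction I rule: infinite_finite_induct)
    (auto intro: coeff_moments_mult[OF assms(1)] coeff_moments_const[OF assms(1)])

lemma poly_eq_sum_bounded:
  fixes p :: "real poly"
  assumes "degree p \<le> n"
  shows "poly p u = (\<Sum>i\<le>n. coeff p i * u ^ i)"
  unfolding poly_altdef using assms
  by (intro sum.mono_neutral_left) (auto simp: coeff_eq_0)

lemma all_moments_poly:
  assumes M: "finite_measure M" and P: "coeff_moments M P" and deg: "\<And>x. degree (P x) \<le> n"
  shows "all_moments M (\<lambda>x. poly (P x) u)"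
  unfolding poly_eq_sum_bounded[OF deg] using P unfolding coeff_moments_def
  by (intro all_moments_sum M all_moments_mult all_moments_const) auto

lemma integral_mult_poly:
  assumes M: "finite_measure M" and Y: "all_moments M Y" and P: "coeff_moments M P"
    and deg: "\<And>x. degree (P x) \<le> n"
  shows "(\<integral>x. Y x * poly (P x) v \<partial>M) = (\<Sum>i\<le>n. (\<integral>x. Y x * coeff (P x) i \<partial>M) * v ^ i)"
proof -
  have int: "integrable M (\<lambda>x. Y x * coeff (P x) i)" for i
    using Y P unfolding coeff_moments_def by (intro all_moments_integrable all_moments_mult) auto
  have "(\<integral>x. Y x * poly (P x) v \<partial>M) = (\<integral>x. (\<Sum>i\<le>n. Y x * coeff (P x) i * v ^ i) \<partial>M)"
    unfolding poly_eq_sum_bounded[OF deg] by (simp add: sum_distrib_left mult_ac)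
  also have "\<dots> = (\<Sum>i\<le>n. (\<integral>x. Y x * coeff (P x) i * v ^ i \<partial>M))"
    by (intro Bochner_Integration.integral_sum integrable_mult_left int)
  finally show ?thesis by simp
qed

text \<open>Differentiation in the argument commutes with the expectation because only finitely many
  coefficients are involved.\<close>

lemma expectation_poly_exists:
  assumes M: "finite_measure M" and Y: "all_moments M Y" and P: "coeff_moments M P"
    and deg: "\<And>x. degree (P x) \<le> n"
  obtains r where "\<And>v. (\<integral>x. Y x * poly (P x) v \<partial>M) = poly r v"
    and "\<And>v. (\<integral>x. Y x * poly (pderiv (P x)) v \<partial>M) = poly (pderiv r) v"
proof
  define r where "r = (\<Sum>i\<le>n. monom (\<integral>x. Y x * coeff (P x) i \<partial>M) i)"
  have r: "coeff r i = (if i \<le> n then \<integral>x. Y x * coeff (P x) i \<partial>M else 0)" for i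
    unfolding r_def by (simp add: coeff_sum)
  have r': "coeff r i = (\<integral>x. Y x * coeff (P x) i \<partial>M)" for i
  proof (cases "i \<le> n")
    case False
    then have "coeff (P x) i = 0" for x using deg[of x] by (intro coeff_eq_0) linarith
    then show ?thesis using False r by simp
  qed (simp add: r)
  have degr: "degree r \<le> n" by (rule degree_le) (simp add: r)
  show "(\<integral>x. Y x * poly (P x) v \<partial>M) = poly r v" for v
    unfolding integral_mult_poly[OF M Y P deg] poly_eq_sum_bounded[OF degr] r' ..
  have deg': "degree (pderiv (P x)) \<le> n" for x using deg[of x] by (simp add: degree_pderiv)
  have degr': "degree (pderiv r) \<le> n" using degr by (simp add: degree_pderiv)
  have "(\<integral>x. Y x * coeff (pderiv (P x)) i \<partial>M) = coeff (pderiv r) i" for i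
  proof -
    have "(\<integral>x. Y x * coeff (pderiv (P x)) i \<partial>M) = (\<integral>x. real (Suc i) * (Y x * coeff (P x) (Suc i)) \<partial>M)"
      unfolding coeff_pderiv by (simp add: mult_ac)
    then show ?thesis by (simp add: coeff_pderiv r')
  qed
  then show "(\<integral>x. Y x * poly (pderiv (P x)) v \<partial>M) = poly (pderiv r) v" for v
    unfolding integral_mult_poly[OF M Y coeff_moments_pderiv[OF M P] deg'] poly_eq_sum_bounded[OF degr'] by simp
qed

text \<open>The recursion divides by \<open>u - v\<close> and is therefore proved only for
  \<open>u \<noteq> v\<close>, while the final integral needs the diagonal; this lemma closes the
  gap.\<close>

lemma poly_eq_off_point:
  fixes p q :: "real poly"
  assumes "\<And>v. v \<noteq> u \<Longrightarrow> poly p v = poly q v"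
  shows "p = q"
proof (rule ccontr)
  assume "p \<noteq> q"
  then have "finite {v. poly (p - q) v = 0}" by (intro poly_roots_finite) simp
  moreover have "UNIV - {u} \<subseteq> {v. poly (p - q) v = 0}" using assms by auto
  ultimately have "finite (UNIV - {u})" by (rule rev_finite_subset)
  then show False by (simp add: infinite_UNIV_char_0)
qed

text \<open>By the Leibniz formula the characteristic polynomial is a finite sum of products of
  polynomials whose coefficients are constants or negated entries.\<close>

lemma char_poly_coeff_moments:
  assumes M: "finite_measure M" and A: "\<And>x. A x \<in> carrier_mat n n"
    and ent: "\<And>i j. i < n \<Longrightarrow> j < n \<Longrightarrow> all_moments M (\<lambda>x. A x $$ (i, j))"
  shows "coeff_moments M (\<lambda>x. char_poly (A x))"
proof -
  have cp: "char_poly (A x) = (\<Sum>p\<in>{p. p permutes {0..<n}}. signof p *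
      (\<Prod>i = 0..<n. [:- (A x $$ (i, p i)), if i = p i then 1 else 0:]))" for x
  proof -
    have "char_poly_matrix (A x) \<in> carrier_mat n n" using A by simp
    then have "char_poly (A x) = (\<Sum>p\<in>{p. p permutes {0..<n}}. signof p *
      (\<Prod>i = 0..<n. char_poly_matrix (A x) $$ (i, p i)))"
      unfolding char_poly_def by (rule det_def')
    also have "\<dots> = (\<Sum>p\<in>{p. p permutes {0..<n}}. signof p *
      (\<Prod>i = 0..<n. [:- (A x $$ (i, p i)), if i = p i then 1 else 0:]))"
    proof (intro sum.cong refl arg_cong2[of _ _ _ _ "(*)"] prod.cong)
      fix p i assume "p \<in> {p. p permutes {0..<n}}" and i: "i \<in> {0..<n}"
      then have "p i < n" using permutes_in_image[of p "{0..<n}" i] by auto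
      then show "char_poly_matrix (A x) $$ (i, p i) = [:- (A x $$ (i, p i)), if i = p i then 1 else 0:]"
        using i A[of x] by (auto simp: char_poly_matrix_def)
    qed
    finally show ?thesis .
  qed
  have "coeff_moments M (\<lambda>x. [:- (A x $$ (i, j)), c:])" if "i < n" "j < n" for i j c
    unfolding coeff_moments_def
  proof
    fix m
    have "all_moments M (\<lambda>x. (-1) * A x $$ (i, j))"
      by (intro all_moments_mult all_moments_const M ent that)
    then show "all_moments M (\<lambda>x. coeff [:- (A x $$ (i, j)), c:] m)"
      by (cases m) (simp_all add: all_moments_const[OF M])
  qed
  then show ?thesis
    unfolding cp by (intro coeff_moments_sum coeff_moments_mult coeff_moments_prod coeff_moments_const M)
      (auto simp: permutes_in_image[of _ "{0..<n}", simplified])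
qed

section \<open>The GOE as a product of normal distributions\<close>

definition entry_var :: "nat \<times> nat \<Rightarrow> real" where
  "entry_var p = (if fst p = snd p then 1 else 1 / 2)"

definition entry_dist :: "nat \<times> nat \<Rightarrow> real measure" where
  "entry_dist p = density lborel (\<lambda>t. ennreal (normal_density 0 (sqrt (entry_var p)) t))"

lemma entry_var_pos: "entry_var p > 0"
  by (simp add: entry_var_def)

lemma prob_space_entry_dist: "prob_space (entry_dist p)"
  unfolding entry_dist_def by (rule prob_space_normal_density) (simp add: entry_var_pos)

lemma sets_entry_dist [measurable_cong, simp]: "sets (entry_dist p) = sets borel"
  by (simp add: entry_dist_def)

lemma space_entry_dist [simp]: "space (entry_dist p) = UNIV"
  by (simp add: entry_dist_def)

interpretation entry: product_sigma_finite entry_dist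
  by (simp add: product_sigma_finite_def prob_space_imp_sigma_finite prob_space_entry_dist)

interpretation lborel_prod: product_sigma_finite "\<lambda>_ :: nat \<times> nat. lborel :: real measure"
  by (simp add: product_sigma_finite_def lborel.sigma_finite_measure_axioms)

lemma prob_space_entries: "prob_space (PiM I entry_dist)"
  by (intro prob_space_PiM prob_space_entry_dist)

lemma integrable_entry_dist: "integrable (entry_dist p) (\<lambda>t. t ^ n)"
  unfolding entry_dist_def
  using integrable_normal_moment[of "sqrt (entry_var p)" 0 n]
  by (subst integrable_density) (auto simp: entry_var_pos)

section \<open>Moments of the entries and Wick's formula\<close>

definition entry_moment :: "nat \<times> nat \<Rightarrow> nat \<Rightarrow> real" where
  "entry_moment p n = (\<integral>t. t ^ n \<partial>entry_dist p)"

lemma entry_moment_eq: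
  "entry_moment p n = (\<integral>t. normal_density 0 (sqrt (entry_var p)) t * (t - 0) ^ n \<partial>lborel)"
  unfolding entry_moment_def entry_dist_def by (subst integral_density) auto

lemma entry_moment_values:
  "entry_moment p 0 = 1" "entry_moment p (Suc 0) = 0" "entry_moment p 2 = entry_var p"
  "entry_moment p 3 = 0" "entry_moment p 4 = 3 * (entry_var p)\<^sup>2"
proof -
  have s: "sqrt (entry_var p) > 0" by (simp add: entry_var_pos)
  have v: "(sqrt (entry_var p))\<^sup>2 = entry_var p" using entry_var_pos[of p] by simp
  note ev = integral_normal_moment_even[OF s, of 0, folded entry_moment_eq, unfolded v]
  note od = integral_normal_moment_odd[OF s, of 0, folded entry_moment_eq]
  show "entry_moment p 0 = 1" using ev[of 0] by simp
  show "entry_moment p (Suc 0) = 0" using od[of 0] by simp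
  show "entry_moment p 2 = entry_var p" using ev[of 1] by (simp add: fact_numeral)
  show "entry_moment p 3 = 0" using od[of 1] by simp
  show "entry_moment p 4 = 3 * (entry_var p)\<^sup>2"
    using ev[of 2] by (simp add: fact_numeral power_divide)
qed

lemma prod_list_eq_prod_count:
  fixes y :: "'a \<Rightarrow> real"
  assumes "finite I" "set ps \<subseteq> I"
  shows "prod_list (map y ps) = (\<Prod>p\<in>I. y p ^ count_list ps p)"
  using assms(2)
proof (induction ps)
  case (Cons q ps)
  have "(\<Prod>p\<in>I. y p ^ count_list (q # ps) p) = (\<Prod>p\<in>I. (if p = q then y p else 1) * y p ^ count_list ps p)"
    by (intro prod.cong) auto
  also have "\<dots> = y q * (\<Prod>p\<in>I. y p ^ count_list ps p)"
    using Cons.prems assms(1) by (simp add: prod.distrib prod.delta)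
  finally show ?case using Cons by simp
qed simp

text \<open>Independence factorises the expectation once equal coordinates are collected into
  powers. A list of coordinates encodes the monomial, with \<open>count_list\<close> as exponent;
  absent coordinates contribute the zeroth moment 1.\<close>

lemma entries_monomial_expectation:
  assumes I: "finite I" and ps: "set ps \<subseteq> I"
  shows "has_bochner_integral (PiM I entry_dist) (\<lambda>y. prod_list (map y ps))
    (\<Prod>p\<in>set ps. entry_moment p (count_list ps p))"
proof -
  have eq: "(\<Prod>p\<in>set ps. entry_moment p (count_list ps p)) = (\<Prod>p\<in>I. entry_moment p (count_list ps p))"
    using I ps by (intro prod.mono_neutral_left) (auto simp: entry_moment_values)
  show ?thesis
    unfolding prod_list_eq_prod_count[OF I ps] eq
    unfolding has_bochner_integral_iff entry_moment_def
    using entry.product_integrable_prod[OF I, of "\<lambda>p t. t ^ count_list ps p"]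
      entry.product_integral_prod[OF I, of "\<lambda>p t. t ^ count_list ps p"]
    by (simp add: integrable_entry_dist)
qed

context
  fixes I :: "(nat \<times> nat) set"
  assumes I: "finite I"
begin

lemma entries_expectation1:
  assumes "p \<in> I"
  shows "has_bochner_integral (PiM I entry_dist) (\<lambda>y. y p) 0"
  using entries_monomial_expectation[OF I, of "[p]"] assms by (simp add: entry_moment_values)

lemma entries_expectation2:
  assumes "p \<in> I" "q \<in> I"
  shows "has_bochner_integral (PiM I entry_dist) (\<lambda>y. y p * y q) (if p = q then entry_var p else 0)"
  using entries_monomial_expectation[OF I, of "[p, q]"] assms
  by (auto simp: entry_moment_values numeral_2_eq_2[symmetric] split: if_splits)

lemma entries_expectation3:
  assumes "p \<in> I" "q \<in> I" "r \<in> I"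
  shows "has_bochner_integral (PiM I entry_dist) (\<lambda>y. y p * (y q * y r)) 0"
proof -
  have eq: "(\<Prod>s\<in>set [p, q, r]. entry_moment s (count_list [p, q, r] s)) = 0"
    by (cases "p = q"; cases "p = r"; cases "q = r")
       (simp_all add: entry_moment_values numeral_2_eq_2[symmetric] numeral_3_eq_3[symmetric])
  have "set [p, q, r] \<subseteq> I" using assms by simp
  from entries_monomial_expectation[OF I this, unfolded eq] show ?thesis by simp
qed

text \<open>Wick's formula for four factors. If all four coordinates coincide, the three pairings
  add up to three times the squared variance, the Gaussian fourth moment; the proof runs through all
  patterns of coincidence.\<close>

lemma entries_expectation4:
  assumes "p \<in> I" "q \<in> I" "r \<in> I" "s \<in> I"
  shows "has_bochner_integral (PiM I entry_dist) (\<lambda>y. (y p * y q) * (y r * y s))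
    ((if p = q \<and> r = s then entry_var p * entry_var r else 0)
     + (if p = r \<and> q = s then entry_var p * entry_var q else 0)
     + (if p = s \<and> q = r then entry_var p * entry_var q else 0))"
proof -
  have four: "Suc (Suc (Suc (Suc 0))) = 4" by simp
  have eq: "(\<Prod>t\<in>set [p, q, r, s]. entry_moment t (count_list [p, q, r, s] t))
    = (if p = q \<and> r = s then entry_var p * entry_var r else 0)
     + (if p = r \<and> q = s then entry_var p * entry_var q else 0)
     + (if p = s \<and> q = r then entry_var p * entry_var q else 0)"
    by (cases "p = q"; cases "p = r"; cases "p = s"; cases "q = r"; cases "q = s"; cases "r = s")
       (simp_all add: entry_moment_values numeral_2_eq_2[symmetric] numeral_3_eq_3[symmetric] four power2_eq_square insert_commute)
  have "set [p, q, r, s] \<subseteq> I" using assms by simp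
  from entries_monomial_expectation[OF I this, unfolded eq] show ?thesis by (simp add: mult.assoc)
qed

lemma entries_all_moments:
  assumes "p \<in> I"
  shows "all_moments (PiM I entry_dist) (\<lambda>y. y p)"
  unfolding all_moments_def
proof (intro conjI allI)
  show m: "(\<lambda>y. y p) \<in> borel_measurable (PiM I entry_dist)"
    using measurable_component_singleton[OF assms, of entry_dist]
    by (simp add: measurable_cong_sets[OF refl sets_entry_dist])
  fix n
  have "integrable (PiM I entry_dist) (\<lambda>y. prod_list (map y (replicate n p)))"
    using entries_monomial_expectation[OF I, of "replicate n p"] assms
    by (auto simp: has_bochner_integral_iff set_replicate_conv_if)
  then have "integrable (PiM I entry_dist) (\<lambda>y. y p ^ n)"
    by (simp add: prod_list_replicate)
  then have "integrable (PiM I entry_dist) (\<lambda>y. \<bar>y p ^ n\<bar>)" by (rule integrable_abs)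
  then show "integrable (PiM I entry_dist) (\<lambda>y. \<bar>y p\<bar> ^ n)" by (simp add: power_abs)
qed

end

text \<open>These are the fresh coordinates when the size grows from \<open>k\<close> to
  \<open>k + 1\<close>: the last column including the corner. By symmetry they also fill the last
  row.\<close>

definition sym_col :: "nat \<Rightarrow> (nat \<times> nat) set" where
  "sym_col k = (\<lambda>i. (i, k)) ` {..k}"

lemma finite_sym_col: "finite (sym_col k)"
  by (simp add: sym_col_def)

lemma mem_sym_col [simp]: "(i, j) \<in> sym_col k \<longleftrightarrow> i \<le> k \<and> j = k"
  by (auto simp: sym_col_def)

lemma mem_sym_idx [simp]: "(i, j) \<in> sym_idx k \<longleftrightarrow> i \<le> j \<and> j < k"
  by (simp add: sym_idx_def)

lemma finite_sym_idx: "finite (sym_idx k)"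
  by (rule finite_subset[of _ "{..<k} \<times> {..<k}"]) auto

lemma sym_idx_Suc: "sym_idx (Suc k) = sym_idx k \<union> sym_col k"
  by auto

lemma sym_idx_disjoint_sym_col: "sym_idx k \<inter> sym_col k = {}"
  by auto

lemma prod_sym_col: "(\<Prod>p\<in>sym_col k. f p) = (\<Prod>i<k. f (i, k)) * f (k, k)"
  unfolding sym_col_def by (subst prod.reindex) (auto simp: inj_on_def lessThan_Suc_atMost[symmetric])

lemma mat_trace_sym_of_square:
  "mat_trace (sym_of k x * sym_of k x) = (\<Sum>i<k. \<Sum>j<k. (if i \<le> j then x (i, j) else x (j, i))\<^sup>2)"
proof -
  have "(sym_of k x * sym_of k x) $$ (i, i) = (\<Sum>j<k. (if i \<le> j then x (i, j) else x (j, i))\<^sup>2)"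
    if "i < k" for i
    using that by (auto simp: sym_of_def scalar_prod_def lessThan_atLeast0 power2_eq_square intro!: sum.cong)
  then show ?thesis by (simp add: mat_trace_def) (simp add: sym_of_def)
qed

lemma normal_density_entry:
  "normal_density 0 (sqrt (entry_var (i, k))) t
    = (if i = k then exp (- t\<^sup>2 / 2) / (sqrt 2 * sqrt pi) else exp (- t\<^sup>2) / sqrt pi)"
  by (simp add: normal_density_def entry_var_def power_divide real_sqrt_mult real_sqrt_divide)

text \<open>An off-diagonal coordinate occurs twice in the trace of the square, hence its variance
  1/2. In the induction a new column contributes \<open>k\<close> such factors and one standard
  normal factor for the corner.\<close>

lemma goe_density_eq_prod:
  "goe_density k x = (\<Prod>p\<in>sym_idx k. normal_density 0 (sqrt (entry_var p)) (x p))"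
proof (induction k)
  case 0
  have "sym_idx 0 = {}" by auto
  then show ?case by (simp add: goe_density_def mat_trace_def sym_of_def)
next
  case (Suc k)
  define T where "T = mat_trace (sym_of k x * sym_of k x)"
  define S where "S = (\<Sum>i<k. (x (i, k))\<^sup>2)"
  have "mat_trace (sym_of (Suc k) x * sym_of (Suc k) x) = T + 2 * S + (x (k, k))\<^sup>2"
    unfolding T_def S_def mat_trace_sym_of_square by (simp add: sum.distrib)
  moreover have "Suc k * (Suc k + 1) div 2 = k * (k + 1) div 2 + Suc k"
    by simp
  ultimately have "goe_density (Suc k) x
     = goe_density k x * (exp (- S) / sqrt pi ^ k * (exp (- (x (k, k))\<^sup>2 / 2) / (sqrt 2 * sqrt pi)))"
    unfolding goe_density_def T_def[symmetric]
    by (simp add: power_add exp_add[symmetric] field_simps flip: exp_add)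
  also have "exp (- S) / sqrt pi ^ k = (\<Prod>i<k. exp (- (x (i, k))\<^sup>2) / sqrt pi)"
    unfolding S_def by (simp add: prod_dividef exp_sum sum_negf[symmetric])
  also have "\<dots> * (exp (- (x (k, k))\<^sup>2 / 2) / (sqrt 2 * sqrt pi))
      = (\<Prod>p\<in>sym_col k. normal_density 0 (sqrt (entry_var p)) (x p))"
    unfolding prod_sym_col normal_density_entry by simp
  finally show ?case
    unfolding sym_idx_Suc Suc
    using finite_sym_idx finite_sym_col sym_idx_disjoint_sym_col by (simp add: prod.union_disjoint)
qed

text \<open>A product measure is determined by its values on boxes, and there the factorised density
  splits the integral into one-dimensional ones.\<close>

lemma GOE_eq_product: "GOE k = PiM (sym_idx k) entry_dist"
proof (rule entry.PiM_eqI[OF finite_sym_idx])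
  let ?I = "sym_idx k" and ?n = "\<lambda>p. normal_density 0 (sqrt (entry_var p))"
  show "sets (GOE k) = sets (PiM ?I entry_dist)"
    unfolding GOE_def by (simp cong: sets_PiM_cong)
  fix A assume A: "\<And>p. p \<in> ?I \<Longrightarrow> A p \<in> sets (entry_dist p)"
  then have A': "\<And>p. p \<in> ?I \<Longrightarrow> A p \<in> sets borel" by simp
  have box: "PiE ?I A \<in> sets (PiM ?I (\<lambda>_. lborel))"
    using A' by (intro sets_PiM_I_finite finite_sym_idx) simp
  have meas: "(\<lambda>x. ennreal (goe_density k x)) \<in> borel_measurable (PiM ?I (\<lambda>_. lborel))"
    unfolding goe_density_eq_prod by measurable
  have "emeasure (GOE k) (PiE ?I A)
      = (\<integral>\<^sup>+x. ennreal (goe_density k x) * indicator (PiE ?I A) x \<partial>PiM ?I (\<lambda>_. lborel))"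
    unfolding GOE_def by (rule emeasure_density[OF meas box])
  also have "\<dots> = (\<integral>\<^sup>+x. (\<Prod>p\<in>?I. ennreal (?n p (x p)) * indicator (A p) (x p)) \<partial>PiM ?I (\<lambda>_. lborel))"
  proof (rule nn_integral_cong)
    fix x assume "x \<in> space (PiM ?I (\<lambda>_. lborel :: real measure))"
    \<comment> \<open>\<open>PiE\<close> also demands extensionality; with it secured, a point
      outside the box must fail at some coordinate of the index set.\<close>
    then have ext: "x \<in> extensional ?I" by (auto simp: space_PiM PiE_def)
    have "indicator (PiE ?I A) x = (\<Prod>p\<in>?I. indicator (A p) (x p) :: ennreal)"
    proof (cases "x \<in> PiE ?I A")
      case True
      then have "indicator (A p) (x p) = (1 :: ennreal)" if "p \<in> ?I" for p
        using PiE_mem[OF _ that] by (simp add: indicator_def)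
      then show ?thesis using True by simp
    next
      case False
      then obtain p where "p \<in> ?I" "x p \<notin> A p" using ext by (auto simp: PiE_def Pi_def)
      then show ?thesis using False finite_sym_idx by (auto intro!: prod_zero[symmetric] bexI[of _ p])
    qed
    then show "ennreal (goe_density k x) * indicator (PiE ?I A) x
        = (\<Prod>p\<in>?I. ennreal (?n p (x p)) * indicator (A p) (x p))"
      unfolding goe_density_eq_prod prod.distrib by (simp add: prod_ennreal)
  qed
  also have "\<dots> = (\<Prod>p\<in>?I. \<integral>\<^sup>+t. ennreal (?n p t) * indicator (A p) t \<partial>lborel)"
    using A' by (intro lborel_prod.product_nn_integral_prod finite_sym_idx) simp
  also have "\<dots> = (\<Prod>p\<in>?I. emeasure (entry_dist p) (A p))"
    using A' unfolding entry_dist_def by (intro prod.cong refl) (simp add: emeasure_density)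
  finally show "emeasure (GOE k) (PiE ?I A) = (\<Prod>p\<in>?I. emeasure (entry_dist p) (A p))" .
qed

section \<open>Correlations of the characteristic polynomial\<close>

text \<open>In the application \<open>\<alpha>\<close> and \<open>\<beta>\<close> are the
  determinants of the inner block shifted by \<open>u\<close> and \<open>v\<close>, and
  \<open>A\<close> and \<open>B\<close> are its cofactors. Odd moments vanish, the corner has
  variance 1, and the other column entries have variance 1/2, so each of the three Wick pairings
  carries 1/4.\<close>

lemma column_expectation:
  fixes A B :: "nat \<Rightarrow> nat \<Rightarrow> real" and k :: nat
  shows "has_bochner_integral (PiM (sym_col k) entry_dist)
    (\<lambda>y. ((u - y (k, k)) * \<alpha> - (\<Sum>i<k. \<Sum>j<k. A i j * (y (i, k) * y (j, k))))
      * ((v - y (k, k)) * \<beta> - (\<Sum>i<k. \<Sum>j<k. B i j * (y (i, k) * y (j, k)))))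
    ((1 + u * v) * \<alpha> * \<beta> - u * \<alpha> / 2 * (\<Sum>i<k. B i i) - v * \<beta> / 2 * (\<Sum>i<k. A i i)
      + ((\<Sum>i<k. A i i) * (\<Sum>i<k. B i i) + (\<Sum>i<k. \<Sum>j<k. A i j * B i j)
         + (\<Sum>i<k. \<Sum>j<k. A i j * B j i)) / 4)"
proof -
  let ?N = "PiM (sym_col k) entry_dist"
  define q where "q C y = (\<Sum>i<k. \<Sum>j<k. C i j * (y (i, k) * y (j, k)))"
    for C :: "nat \<Rightarrow> nat \<Rightarrow> real" and y
  note fin = finite_sym_col[of k]
  interpret N: prob_space ?N by (rule prob_space_entries)
  have one: "has_bochner_integral ?N (\<lambda>_. 1) (1 :: real)"
    by (simp add: has_bochner_integral_iff N.prob_space)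
  have a: "has_bochner_integral ?N (\<lambda>y. y (k, k)) 0"
    by (rule entries_expectation1[OF fin]) simp
  have aa: "has_bochner_integral ?N (\<lambda>y. y (k, k) * y (k, k)) 1"
    using entries_expectation2[OF fin, of "(k, k)" "(k, k)"] by (simp add: entry_var_def)
  have Q: "has_bochner_integral ?N (q C) ((\<Sum>i<k. C i i) / 2)" for C
  proof -
    have "has_bochner_integral ?N (q C) (\<Sum>i<k. \<Sum>j<k. C i j * (if i = j then 1 / 2 else 0))"
      unfolding q_def[abs_def]
    proof (intro has_bochner_integral_sum has_bochner_integral_mult_right)
      fix i j assume "i \<in> {..<k}" "j \<in> {..<k}"
      then show "has_bochner_integral ?N (\<lambda>y. y (i, k) * y (j, k)) (if i = j then 1 / 2 else 0)"
        using entries_expectation2[OF fin, of "(i, k)" "(j, k)"] by (auto simp: entry_var_def)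
    qed
    also have "(\<Sum>i<k. \<Sum>j<k. C i j * (if i = j then 1 / 2 else 0)) = (\<Sum>i<k. C i i) / 2"
      by (simp add: if_distrib sum.delta sum_divide_distrib cong: if_cong)
    finally show ?thesis .
  qed
  have aQ: "has_bochner_integral ?N (\<lambda>y. y (k, k) * q C y) 0" for C
  proof -
    have "has_bochner_integral ?N (\<lambda>y. \<Sum>i<k. \<Sum>j<k. C i j * (y (k, k) * (y (i, k) * y (j, k))))
        (\<Sum>i<k. \<Sum>j<k. C i j * 0)"
      by (intro has_bochner_integral_sum has_bochner_integral_mult_right entries_expectation3[OF fin]) auto
    then show ?thesis unfolding q_def by (simp add: sum_distrib_left mult_ac)
  qed
  have QQ: "has_bochner_integral ?N (\<lambda>y. q A y * q B y)
      (((\<Sum>i<k. A i i) * (\<Sum>i<k. B i i) + (\<Sum>i<k. \<Sum>j<k. A i j * B i j)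
         + (\<Sum>i<k. \<Sum>j<k. A i j * B j i)) / 4)"
  proof -
    let ?m = "\<lambda>i j l m. (if i = j \<and> l = m then 1/4 else 0) + (if i = l \<and> j = m then 1/4 else 0)
      + (if i = m \<and> j = l then 1/4 else 0 :: real)"
    have wick: "has_bochner_integral ?N (\<lambda>y. (y (i, k) * y (j, k)) * (y (l, k) * y (m, k))) (?m i j l m)"
      if *: "i \<in> {..<k}" "j \<in> {..<k}" "l \<in> {..<k}" "m \<in> {..<k}" for i j l m
    proof -
      from * have ev: "entry_var (i, k) = 1/2" "entry_var (j, k) = 1/2" "entry_var (l, k) = 1/2"
        by (auto simp: entry_var_def)
      from * have mem: "(i, k) \<in> sym_col k" "(j, k) \<in> sym_col k" "(l, k) \<in> sym_col k" "(m, k) \<in> sym_col k"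
        by auto
      have quarter: "(1/2) * (1/2) = (1/4 :: real)" by simp
      show ?thesis
        using entries_expectation4[OF fin mem] unfolding ev quarter prod.inject simp_thms .
    qed
    have "has_bochner_integral ?N (\<lambda>y. \<Sum>i<k. \<Sum>j<k. \<Sum>l<k. \<Sum>m<k.
        (A i j * B l m) * ((y (i, k) * y (j, k)) * (y (l, k) * y (m, k))))
        (\<Sum>i<k. \<Sum>j<k. \<Sum>l<k. \<Sum>m<k. (A i j * B l m) * ?m i j l m)"
      by (intro has_bochner_integral_sum has_bochner_integral_mult_right wick)
    also have "(\<lambda>y. \<Sum>i<k. \<Sum>j<k. \<Sum>l<k. \<Sum>m<k.
        (A i j * B l m) * ((y (i, k) * y (j, k)) * (y (l, k) * y (m, k)))) = (\<lambda>y. q A y * q B y)"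
      unfolding q_def sum_distrib_right unfolding sum_distrib_left
      by (intro ext) (simp add: mult_ac)
    also have "(\<Sum>i<k. \<Sum>j<k. \<Sum>l<k. \<Sum>m<k. (A i j * B l m) * ?m i j l m)
      = ((\<Sum>i<k. A i i) * (\<Sum>i<k. B i i) + (\<Sum>i<k. \<Sum>j<k. A i j * B i j)
         + (\<Sum>i<k. \<Sum>j<k. A i j * B j i)) / 4"
    proof -
      have 1: "(\<Sum>i<k. \<Sum>j<k. \<Sum>l<k. \<Sum>m<k. (A i j * B l m) * (if i = j \<and> l = m then 1/4 else 0))
          = (\<Sum>i<k. A i i) * (\<Sum>i<k. B i i) / 4"
      proof -
        have "(\<Sum>l<k. \<Sum>m<k. (A i j * B l m) * (if i = j \<and> l = m then 1/4 else 0))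
          = (if i = j then A i i * (\<Sum>l<k. B l l) / 4 else 0)" for i j
          by (simp add: if_distrib sum.delta sum_distrib_left sum_divide_distrib cong: if_cong)
        then show ?thesis by (simp add: sum.delta sum_distrib_right sum_divide_distrib)
      qed
      have 2: "(\<Sum>i<k. \<Sum>j<k. \<Sum>l<k. \<Sum>m<k. (A i j * B l m) * (if i = l \<and> j = m then 1/4 else 0))
          = (\<Sum>i<k. \<Sum>j<k. A i j * B i j) / 4"
      proof -
        have "(\<Sum>l<k. \<Sum>m<k. (A i j * B l m) * (if i = l \<and> j = m then 1/4 else 0))
          = A i j * B i j / 4" if "i < k" "j < k" for i j
        proof -
          have "(\<Sum>m<k. (A i j * B l m) * (if i = l \<and> j = m then 1/4 else 0))
            = (if i = l then A i j * B i j / 4 else 0)" for l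
            using that by (simp add: if_distrib sum.delta cong: if_cong)
          then show ?thesis using that by (simp add: sum.delta)
        qed
        then show ?thesis unfolding sum_divide_distrib by (intro sum.cong refl) auto
      qed
      have 3: "(\<Sum>i<k. \<Sum>j<k. \<Sum>l<k. \<Sum>m<k. (A i j * B l m) * (if i = m \<and> j = l then 1/4 else 0))
          = (\<Sum>i<k. \<Sum>j<k. A i j * B j i) / 4"
      proof -
        have "(\<Sum>l<k. \<Sum>m<k. (A i j * B l m) * (if i = m \<and> j = l then 1/4 else 0))
          = A i j * B j i / 4" if "i < k" "j < k" for i j
        proof -
          have "(\<Sum>m<k. (A i j * B l m) * (if i = m \<and> j = l then 1/4 else 0))
            = (if j = l then A i j * B j i / 4 else 0)" for l
            using that by (simp add: if_distrib sum.delta cong: if_cong)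
          then show ?thesis using that by (simp add: sum.delta)
        qed
        then show ?thesis unfolding sum_divide_distrib by (intro sum.cong refl) auto
      qed
      show ?thesis
        unfolding distrib_left sum.distrib 1 2 3 by (simp add: add_divide_distrib)
    qed
    finally show ?thesis .
  qed
  \<comment> \<open>The product is multiplied out into constants, the corner, its square, the
    quadratic forms and mixed terms. The squared corner supplies the 1 in
    \<open>1 + u * v\<close>.\<close>
  note comb = has_bochner_integral_add[OF has_bochner_integral_add[OF has_bochner_integral_add[OF
      has_bochner_integral_mult_right[OF one, of "u * v * \<alpha> * \<beta>"]
      has_bochner_integral_mult_right[OF a, of "- (u + v) * \<alpha> * \<beta>"]]
      has_bochner_integral_add[OF has_bochner_integral_mult_right[OF aa, of "\<alpha> * \<beta>"] QQ]]
      has_bochner_integral_add[OF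
        has_bochner_integral_add[OF has_bochner_integral_mult_right[OF Q, of "- u * \<alpha>" B]
          has_bochner_integral_mult_right[OF Q, of "- v * \<beta>" A]]
        has_bochner_integral_add[OF has_bochner_integral_mult_right[OF aQ, of "\<alpha>" B]
          has_bochner_integral_mult_right[OF aQ, of "\<beta>" A]]]]
  show ?thesis
    unfolding q_def[symmetric]
    by (rule has_bochner_integral_cong[THEN iffD1, OF refl _ _ comb]) (simp_all add: algebra_simps)
qed

section \<open>Averaging the characteristic polynomials over the last column\<close>

lemma sym_of_carrier [simp]: "sym_of k x \<in> carrier_mat k k"
  by (simp add: sym_of_def)

lemma char_poly_sym_of_bordered:
  fixes k x y
  defines "M \<equiv> \<lambda>u. u \<cdot>\<^sub>m 1\<^sub>m k - sym_of k x"
  shows "poly (char_poly (sym_of (Suc k) (merge (sym_idx k) (sym_col k) (x, y)))) u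
    = (u - y (k, k)) * det (M u) - (\<Sum>i<k. \<Sum>j<k. cofactor (M u) i j * (y (i, k) * y (j, k)))"
proof -
  define z where "z = merge (sym_idx k) (sym_col k) (x, y)"
  have zx: "z (i, j) = x (i, j)" if "i \<le> j" "j < k" for i j
    using that by (simp add: z_def merge_def)
  have zy: "z (i, k) = y (i, k)" if "i \<le> k" for i
    using that by (simp add: z_def merge_def)
  let ?B = "u \<cdot>\<^sub>m 1\<^sub>m (Suc k) - sym_of (Suc k) z"
  have B: "?B \<in> carrier_mat (Suc k) (Suc k)" by (intro minus_carrier_mat sym_of_carrier)
  have sub: "mat k k (\<lambda>(i, j). ?B $$ (i, j)) = M u"
    by (intro eq_matI) (auto simp: M_def sym_of_def zx)
  have "?B $$ (k, k) = u - y (k, k)" by (simp add: sym_of_def zy)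
  moreover have "?B $$ (i, k) = - y (i, k)" "?B $$ (k, i) = - y (i, k)" if "i < k" for i
    using that by (simp_all add: sym_of_def zy)
  ultimately have "det ?B = (u - y (k, k)) * det (M u)
      - (\<Sum>i<k. \<Sum>j<k. cofactor (M u) i j * (y (i, k) * y (j, k)))"
    unfolding det_bordered[OF B] sub by (simp add: mult_ac)
  then show ?thesis
    unfolding poly_char_poly[OF sym_of_carrier] z_def .
qed

text \<open>The traces of the cofactor matrices become derivatives of \<open>p\<close>. The two
  crossed pairings agree by symmetry, so together they give half of the cofactor sum that the
  resolvent identity expresses through \<open>p\<close>.\<close>

lemma column_expectation_char_poly:
  fixes k x
  assumes uv: "u \<noteq> v"
  defines "p \<equiv> char_poly (sym_of k x)"
  shows "(\<integral>y. poly (char_poly (sym_of (Suc k) (merge (sym_idx k) (sym_col k) (x, y)))) u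
        * poly (char_poly (sym_of (Suc k) (merge (sym_idx k) (sym_col k) (x, y)))) v
        \<partial>PiM (sym_col k) entry_dist)
    = (1 + u * v) * (poly p u * poly p v)
      - u / 2 * (poly p u * poly (pderiv p) v) - v / 2 * (poly p v * poly (pderiv p) u)
      + 1 / 4 * (poly (pderiv p) u * poly (pderiv p) v)
      + 1 / (2 * (u - v)) * (poly p u * poly (pderiv p) v - poly p v * poly (pderiv p) u)"
proof -
  define M where "M = (\<lambda>u. u \<cdot>\<^sub>m 1\<^sub>m k - sym_of k x)"
  have M: "M u \<in> carrier_mat k k" for u unfolding M_def by (intro minus_carrier_mat sym_of_carrier)
  have Mw: "w \<cdot>\<^sub>m 1\<^sub>m k - sym_of k x = M w" for w by (simp add: M_def)
  have sym: "(M u)\<^sup>T = M u" for u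
    by (intro eq_matI) (auto simp: M_def sym_of_def)
  have d: "det (M w) = poly p w" for w
    unfolding p_def M_def poly_char_poly[OF sym_of_carrier] ..
  have t: "(\<Sum>i<k. cofactor (M w) i i) = poly (pderiv p) w" for w
    unfolding p_def M_def poly_pderiv_char_poly[OF sym_of_carrier] ..
  have "(u - v) * (\<Sum>i<k. \<Sum>j<k. cofactor (M u) i j * cofactor (M v) j i)
      = poly p u * poly (pderiv p) v - poly p v * poly (pderiv p) u"
    using cofactor_resolvent[OF sym_of_carrier, of u v k x] unfolding Mw d t .
  moreover define R where "R = (\<Sum>i<k. \<Sum>j<k. cofactor (M u) i j * cofactor (M v) j i)"
  ultimately have half: "1 / (2 * (u - v)) * (poly p u * poly (pderiv p) v - poly p v * poly (pderiv p) u) = R / 2"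
    using uv by (simp add: field_simps)
  have R': "(\<Sum>i<k. \<Sum>j<k. cofactor (M u) i j * cofactor (M v) i j) = R"
    unfolding R_def by (intro sum.cong refl) (simp add: cofactor_symmetric[OF M sym])
  show ?thesis
    unfolding char_poly_sym_of_bordered Mw
      has_bochner_integral_integral_eq[OF column_expectation] d t R' R_def[symmetric] half
    by (simp add: field_simps)
qed

lemma char_poly_sym_of_coeff_moments:
  "coeff_moments (PiM (sym_idx k) entry_dist) (\<lambda>x. char_poly (sym_of k x))"
proof (rule char_poly_coeff_moments[OF _ sym_of_carrier])
  show "finite_measure (PiM (sym_idx k) entry_dist)"
    using prob_space_entries by (rule prob_space.finite_measure)
  fix i j assume "i < k" "j < k"
  then show "all_moments (PiM (sym_idx k) entry_dist) (\<lambda>x. sym_of k x $$ (i, j))"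
    by (cases "i \<le> j") (auto simp: sym_of_def intro!: entries_all_moments finite_sym_idx)
qed

lemma degree_char_poly_sym_of: "degree (char_poly (sym_of k x)) \<le> k"
  using degree_monic_char_poly[OF sym_of_carrier] by auto

text \<open>This is why the weights \<open>k + 1 - j\<close> reproduce themselves under the
  recursion; the factor \<open>(k + 1) / 2\<close> turns \<open>k!/2^k\<close> into its
  successor.\<close>

lemma weighted_partial_sums:
  fixes g :: "nat \<Rightarrow> real"
  shows "(\<Sum>j\<le>k. (real k + 1 - real j) * ((\<Sum>i\<le>j. g i) + (real j + 1) / 2 * g (Suc j)))
    = (real k + 1) / 2 * (\<Sum>j\<le>Suc k. (real k + 2 - real j) * g j)"
proof (induction k)
  case 0
  then show ?case by simp
next
  case (Suc k)
  let ?t = "\<lambda>j. (\<Sum>i\<le>j. g i) + (real j + 1) / 2 * g (Suc j)"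
  \<comment> \<open>Increasing \<open>k\<close> by one raises every weight by one, so the induction
    step needs the unweighted sum of \<open>?t\<close>.\<close>
  have partial: "(\<Sum>j\<le>m. ?t j) = (\<Sum>j\<le>Suc m. (real m + 1 - real j / 2) * g j)" for m
  proof (induction m)
    case (Suc m)
    have "(\<Sum>j\<le>Suc m. (real (Suc m) + 1 - real j / 2) * g j)
        = (\<Sum>j\<le>Suc m. (real m + 1 - real j / 2) * g j) + (\<Sum>j\<le>Suc m. g j)"
      unfolding sum.distrib[symmetric] by (intro sum.cong refl) (simp add: algebra_simps)
    then show ?case using Suc by (simp add: field_simps)
  qed simp
  have "(\<Sum>j\<le>Suc k. (real (Suc k) + 1 - real j) * ?t j)
      = (\<Sum>j\<le>Suc k. (real k + 1 - real j) * ?t j) + (\<Sum>j\<le>Suc k. ?t j)"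
  proof -
    have "(real (Suc k) + 1 - real j) * t = (real k + 1 - real j) * t + t" for j t
      by (simp add: algebra_simps)
    then show ?thesis by (simp only: sum.distrib)
  qed
  \<comment> \<open>The weight is zero at \<open>j = k + 1\<close>. Likewise
    \<open>k + 2 - j\<close> is zero at \<open>j = k + 2\<close>, which below pads the sum to the
    range of the target.\<close>
  also have "(\<Sum>j\<le>Suc k. (real k + 1 - real j) * ?t j) = (\<Sum>j\<le>k. (real k + 1 - real j) * ?t j)"
    by simp
  also have "\<dots> = (\<Sum>j\<le>Suc k. (real k + 1) / 2 * ((real k + 2 - real j) * g j))"
    unfolding Suc sum_distrib_left ..
  also have "\<dots> = (\<Sum>j\<le>Suc (Suc k). (real k + 1) / 2 * ((real k + 2 - real j) * g j))"
    by simp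
  also have "\<dots> + (\<Sum>j\<le>Suc k. ?t j)
      = (\<Sum>j\<le>Suc (Suc k). (real (Suc k) + 1) / 2 * ((real (Suc k) + 2 - real j) * g j))"
    unfolding partial sum.distrib[symmetric] by (intro sum.cong refl) (simp add: field_simps)
  finally show ?case unfolding sum_distrib_left .
qed

definition hermite_weight :: "nat \<Rightarrow> nat \<Rightarrow> real" where
  "hermite_weight k j = fact k / 2 ^ k * (real k + 1 - real j) / hermite_norm j"

text \<open>The first four terms are \<open>h j u * h j v\<close> plus the product raised in both
  arguments, and the last term gives the normalised products of index below \<open>j\<close>. The
  unraised product completes that partial sum to \<open>i \<le> j\<close>.\<close>

lemma hermite_weight_recurrence:
  assumes uv: "u \<noteq> v"
  defines "h \<equiv> \<lambda>j. poly (hermite j)" and "h' \<equiv> \<lambda>j. poly (pderiv (hermite j))"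
  shows "(\<Sum>j\<le>k. hermite_weight k j * ((1 + u * v) * (h j u * h j v)
      - u / 2 * (h j u * h' j v) - v / 2 * (h j v * h' j u) + 1 / 4 * (h' j u * h' j v)
      + 1 / (2 * (u - v)) * (h j u * h' j v - h j v * h' j u)))
    = (\<Sum>j\<le>Suc k. hermite_weight (Suc k) j * (h j u * h j v))"
proof -
  define g where "g j = h j u * h j v / hermite_norm j" for j
  have hg: "h j u * h j v = hermite_norm j * g j" for j by (simp add: g_def)
  have raise: "h (Suc j) w = w * h j w - h' j w / 2" for j w
    by (simp add: h_def h'_def)
  have w: "1 / (2 * (u - v)) * (h j u * h' j v - h j v * h' j u) = hermite_norm j * (\<Sum>i<j. g i)" for j
  proof -
    have "h j u * h' j v - h j v * h' j u = 2 * (u - v) * (hermite_norm j * (\<Sum>i<j. g i))"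
      unfolding h_def h'_def hermite_wronskian g_def by (simp add: sum_distrib_left mult_ac)
    then show ?thesis using uv by simp
  qed
  have "(1 + u * v) * (h j u * h j v)
      - u / 2 * (h j u * h' j v) - v / 2 * (h j v * h' j u) + 1 / 4 * (h' j u * h' j v)
      + 1 / (2 * (u - v)) * (h j u * h' j v - h j v * h' j u)
    = hermite_norm j * ((\<Sum>i\<le>j. g i) + (real j + 1) / 2 * g (Suc j))" for j
  proof -
    have "(1 + u * v) * (h j u * h j v)
      - u / 2 * (h j u * h' j v) - v / 2 * (h j v * h' j u) + 1 / 4 * (h' j u * h' j v)
      = h j u * h j v + h (Suc j) u * h (Suc j) v"
      unfolding raise by (simp add: field_simps)
    also have "\<dots> = hermite_norm j * (g j + (real j + 1) / 2 * g (Suc j))"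
      unfolding hg hermite_norm_Suc by (simp add: algebra_simps)
    finally show ?thesis
      unfolding w by (simp add: algebra_simps flip: lessThan_Suc_atMost)
  qed
  then have "(\<Sum>j\<le>k. hermite_weight k j * ((1 + u * v) * (h j u * h j v)
      - u / 2 * (h j u * h' j v) - v / 2 * (h j v * h' j u) + 1 / 4 * (h' j u * h' j v)
      + 1 / (2 * (u - v)) * (h j u * h' j v - h j v * h' j u)))
    = fact k / 2 ^ k * (\<Sum>j\<le>k. (real k + 1 - real j) * ((\<Sum>i\<le>j. g i) + (real j + 1) / 2 * g (Suc j)))"
    by (simp add: hermite_weight_def sum_distrib_left mult_ac)
  also have "\<dots> = fact (Suc k) / 2 ^ Suc k * (\<Sum>j\<le>Suc k. (real (Suc k) + 1 - real j) * g j)"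
    unfolding weighted_partial_sums by (simp add: add_ac mult_ac)
  also have "\<dots> = (\<Sum>j\<le>Suc k. hermite_weight (Suc k) j * (h j u * h j v))"
    unfolding sum_distrib_left hermite_weight_def g_def by (intro sum.cong refl) simp
  finally show ?thesis .
qed

text \<open>Induction on the size: integrate out the last column first, then insert the induction
  hypothesis and its derivatives in either argument. Keeping \<open>u\<close> and \<open>v\<close>
  arbitrary is what permits these derivatives.\<close>

lemma char_poly_correlation:
  "(\<integral>x. poly (char_poly (sym_of k x)) u * poly (char_poly (sym_of k x)) v \<partial>PiM (sym_idx k) entry_dist)
    = (\<Sum>j\<le>k. hermite_weight k j * (poly (hermite j) u * poly (hermite j) v))"
proof (induction k arbitrary: u v)
  case 0
  interpret prob_space "PiM (sym_idx 0) entry_dist" by (rule prob_space_entries)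
  have "char_poly (sym_of 0 x) = 1" for x
    unfolding char_poly_def by (rule det_dim_zero) simp
  then show ?case by (simp add: hermite_weight_def hermite_norm_def prob_space)
next
  case (Suc k)
  let ?N = "\<lambda>k. PiM (sym_idx k) entry_dist" and ?p = "\<lambda>k x. char_poly (sym_of k x)"
  let ?w = "hermite_weight k"
  have fin: "finite_measure (?N k)" for k
    using prob_space_entries by (rule prob_space.finite_measure)
  note cm = char_poly_sym_of_coeff_moments and deg = degree_char_poly_sym_of
  have deg': "degree (pderiv (?p k x)) \<le> k" for k x
    using deg[of k x] by (simp add: degree_pderiv)
  have am: "all_moments (?N k) (\<lambda>x. poly (?p k x) u)" for k u
    by (rule all_moments_poly[OF fin cm]) (rule deg)
  have am': "all_moments (?N k) (\<lambda>x. poly (pderiv (?p k x)) u)" for k u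
    by (rule all_moments_poly[OF fin coeff_moments_pderiv[OF fin cm]]) (rule deg')
  \<comment> \<open>The expectation is a polynomial in \<open>v\<close>, hence determined by its
    values, so a known Hermite expansion may be differentiated term by term. Used once for
    \<open>E1\<close>, and again for \<open>E2\<close> after exchanging the arguments.\<close>
  have diff: "(\<integral>x. Y x * poly (pderiv (?p k x)) v \<partial>?N k) = (\<Sum>j\<le>k. c j * poly (pderiv (hermite j)) v)"
    if Y: "all_moments (?N k) Y"
      and eq: "\<And>v. (\<integral>x. Y x * poly (?p k x) v \<partial>?N k) = (\<Sum>j\<le>k. c j * poly (hermite j) v)" for Y c v
  proof -
    obtain r where r: "\<And>v. (\<integral>x. Y x * poly (?p k x) v \<partial>?N k) = poly r v"
      "\<And>v. (\<integral>x. Y x * poly (pderiv (?p k x)) v \<partial>?N k) = poly (pderiv r) v"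
      by (rule expectation_poly_exists[OF fin Y cm, of k]) (rule deg, blast)
    have "poly r v = poly (\<Sum>j\<le>k. smult (c j) (hermite j)) v" for v
      using eq[of v] r(1)[of v] by (simp add: poly_sum)
    then have "r = (\<Sum>j\<le>k. smult (c j) (hermite j))" by (rule poly_eq_off_point)
    then show ?thesis unfolding r(2) by (simp add: pderiv_sum pderiv_smult poly_sum)
  qed
  have E1: "(\<integral>x. poly (?p k x) u * poly (pderiv (?p k x)) v \<partial>?N k)
      = (\<Sum>j\<le>k. ?w j * (poly (hermite j) u * poly (pderiv (hermite j)) v))" for u v
    using diff[OF am, of u "\<lambda>j. ?w j * poly (hermite j) u" v] Suc.IH by (simp add: mult.assoc)
  have E2: "(\<integral>x. poly (pderiv (?p k x)) u * poly (pderiv (?p k x)) v \<partial>?N k)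
      = (\<Sum>j\<le>k. ?w j * (poly (pderiv (hermite j)) u * poly (pderiv (hermite j)) v))" for u v
  proof -
    have "(\<integral>x. poly (pderiv (?p k x)) u * poly (?p k x) v \<partial>?N k)
      = (\<Sum>j\<le>k. ?w j * poly (pderiv (hermite j)) u * poly (hermite j) v)" for v
      using E1[of v u] by (simp add: mult_ac)
    then show ?thesis
      using diff[OF am', of u "\<lambda>j. ?w j * poly (pderiv (hermite j)) u" v] by (simp add: mult.assoc)
  qed
  have off: "(\<integral>x. poly (?p (Suc k) x) u * poly (?p (Suc k) x) v \<partial>?N (Suc k))
      = (\<Sum>j\<le>Suc k. hermite_weight (Suc k) j * (poly (hermite j) u * poly (hermite j) v))"
    if uv: "u \<noteq> v" for u v
  proof -
    have int: "integrable (?N (Suc k)) (\<lambda>x. poly (?p (Suc k) x) u * poly (?p (Suc k) x) v)"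
      by (intro all_moments_integrable all_moments_mult am)
    have lin: "(\<integral>x. a * f x - b * g x - c * h x + d * i x + e * (g x - h x) \<partial>?N k)
        = a * (\<integral>x. f x \<partial>?N k) - b * (\<integral>x. g x \<partial>?N k) - c * (\<integral>x. h x \<partial>?N k) + d * (\<integral>x. i x \<partial>?N k)
          + e * ((\<integral>x. g x \<partial>?N k) - (\<integral>x. h x \<partial>?N k))"
      if "integrable (?N k) f" "integrable (?N k) g" "integrable (?N k) h" "integrable (?N k) i"
      for a b c d e :: real and f g h i
      using that by simp
    have "(\<integral>x. poly (?p (Suc k) x) u * poly (?p (Suc k) x) v \<partial>?N (Suc k))
      = (\<integral>x. (1 + u * v) * (poly (?p k x) u * poly (?p k x) v)
      - u / 2 * (poly (?p k x) u * poly (pderiv (?p k x)) v) - v / 2 * (poly (?p k x) v * poly (pderiv (?p k x)) u)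
      + 1 / 4 * (poly (pderiv (?p k x)) u * poly (pderiv (?p k x)) v)
      + 1 / (2 * (u - v)) * (poly (?p k x) u * poly (pderiv (?p k x)) v - poly (?p k x) v * poly (pderiv (?p k x)) u) \<partial>?N k)"
      using entry.product_integral_fold[OF sym_idx_disjoint_sym_col finite_sym_idx finite_sym_col
          int[unfolded sym_idx_Suc]]
      unfolding sym_idx_Suc column_expectation_char_poly[OF uv] .
    also have "\<dots> = (1 + u * v) * (\<integral>x. poly (?p k x) u * poly (?p k x) v \<partial>?N k)
      - u / 2 * (\<integral>x. poly (?p k x) u * poly (pderiv (?p k x)) v \<partial>?N k)
      - v / 2 * (\<integral>x. poly (?p k x) v * poly (pderiv (?p k x)) u \<partial>?N k)
      + 1 / 4 * (\<integral>x. poly (pderiv (?p k x)) u * poly (pderiv (?p k x)) v \<partial>?N k)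
      + 1 / (2 * (u - v)) * ((\<integral>x. poly (?p k x) u * poly (pderiv (?p k x)) v \<partial>?N k)
         - (\<integral>x. poly (?p k x) v * poly (pderiv (?p k x)) u \<partial>?N k))"
      by (rule lin; rule all_moments_integrable[OF all_moments_mult]; rule am am')
    also have "\<dots> = (\<Sum>j\<le>Suc k. hermite_weight (Suc k) j * (poly (hermite j) u * poly (hermite j) v))"
      unfolding Suc.IH E1 E2 hermite_weight_recurrence[OF uv, symmetric]
        sum_distrib_left sum_subtractf[symmetric] sum.distrib[symmetric]
      by (intro sum.cong refl) (simp only: algebra_simps)
    finally show ?thesis .
  qed
  \<comment> \<open>For fixed \<open>u\<close> both sides are polynomials in \<open>v\<close> that
    agree away from \<open>v = u\<close>, hence also at that point.\<close>
  obtain r where r: "\<And>v. (\<integral>x. poly (?p (Suc k) x) u * poly (?p (Suc k) x) v \<partial>?N (Suc k)) = poly r v"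
    by (rule expectation_poly_exists[OF fin am[of "Suc k" u] cm, of "Suc k"]) (rule deg, blast)
  have "r = (\<Sum>j\<le>Suc k. smult (hermite_weight (Suc k) j * poly (hermite j) u) (hermite j))"
  proof (rule poly_eq_off_point[of u])
    fix v assume "v \<noteq> u"
    then show "poly r v = poly (\<Sum>j\<le>Suc k. smult (hermite_weight (Suc k) j * poly (hermite j) u) (hermite j)) v"
      using off[of u v] r[of v] by (simp only: poly_sum poly_smult mult.assoc)
  qed
  then show ?case unfolding r by (simp only: poly_sum poly_smult mult.assoc)
qed

text \<open>Reversing the sign of the matrix costs \<open>(-1) ^ k\<close>, which squaring
  removes.\<close>

lemma det_sym_of_shift_square:
  "(det (sym_of k x - u \<cdot>\<^sub>m 1\<^sub>m k))\<^sup>2 = poly (char_poly (sym_of k x)) u * poly (char_poly (sym_of k x)) u"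
proof -
  let ?A = "u \<cdot>\<^sub>m 1\<^sub>m k - sym_of k x"
  have "sym_of k x - u \<cdot>\<^sub>m 1\<^sub>m k = (-1) \<cdot>\<^sub>m ?A"
    by (intro eq_matI) (auto simp: sym_of_def)
  then have "det (sym_of k x - u \<cdot>\<^sub>m 1\<^sub>m k) = (-1) ^ k * det ?A"
    by (simp add: det_smult sym_of_def)
  then show ?thesis
    unfolding poly_char_poly[OF sym_of_carrier]
    by (simp add: power_mult_distrib power2_eq_square flip: power_mult)
qed

lemma sum_descending: "(\<Sum>j\<le>k. real k + 1 - real j) = (real k + 1) * (real k + 2) / 2"
proof (induction k)
  case (Suc k)
  have "(\<Sum>j\<le>Suc k. real (Suc k) + 1 - real j) = (\<Sum>j\<le>Suc k. (real k + 1 - real j) + 1)"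
    by (intro sum.cong) auto
  also have "\<dots> = (\<Sum>j\<le>k. real k + 1 - real j) + (real k + 2)"
    unfolding sum.distrib by simp
  finally show ?case unfolding Suc by (simp add: field_simps)
qed simp

theorem theorem1p6:
  fixes k :: nat
  assumes "k \<ge> 1"
  shows "(\<forall>u::real. integrable (GOE k)
            (\<lambda>x. (det (sym_of k x - u \<cdot>\<^sub>m 1\<^sub>m k))\<^sup>2))
       \<and> has_bochner_integral lborel
            (\<lambda>u::real. (\<integral>x. (det (sym_of k x - u \<cdot>\<^sub>m 1\<^sub>m k))\<^sup>2 \<partial>GOE k) * exp (- u\<^sup>2))
            (sqrt pi * fact (k + 2) / 2 ^ (k + 1))"
proof (intro conjI allI)
  have fin: "finite_measure (PiM (sym_idx k) entry_dist)"
    using prob_space_entries by (rule prob_space.finite_measure)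
  \<comment> \<open>This makes the inner integral a genuine expectation rather than the default
    value 0 of a non-integrable function.\<close>
  show "integrable (GOE k) (\<lambda>x. (det (sym_of k x - u \<cdot>\<^sub>m 1\<^sub>m k))\<^sup>2)" for u :: real
    unfolding det_sym_of_shift_square GOE_eq_product
    by (intro all_moments_integrable all_moments_mult
        all_moments_poly[OF fin char_poly_sym_of_coeff_moments degree_char_poly_sym_of])
  \<comment> \<open>The correlation at \<open>v = u\<close>, integrated termwise. Each norm cancels
    the one in the denominator of \<open>hermite_weight\<close>, leaving the arithmetic sum of
    \<open>k + 1 - j\<close>.\<close>
  have "has_bochner_integral lborel
      (\<lambda>u. \<Sum>j\<le>k. hermite_weight k j * (poly (hermite j * hermite j) u * exp (- u\<^sup>2)))
      (\<Sum>j\<le>k. hermite_weight k j * (sqrt pi * hermite_norm j))"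
  proof (intro has_bochner_integral_sum has_bochner_integral_mult_right)
    fix j
    show "has_bochner_integral lborel (\<lambda>u. poly (hermite j * hermite j) u * exp (- u\<^sup>2))
        (sqrt pi * hermite_norm j)"
      using gauss_functional_hermite_square[of j] integrable_poly_gauss[of "hermite j * hermite j"]
      unfolding has_bochner_integral_iff gauss_functional_def by blast
  qed
  also have "(\<Sum>j\<le>k. hermite_weight k j * (sqrt pi * hermite_norm j))
      = sqrt pi * (fact k / 2 ^ k) * (\<Sum>j\<le>k. real k + 1 - real j)"
    unfolding sum_distrib_left hermite_weight_def by (intro sum.cong refl) simp
  also have "\<dots> = sqrt pi * fact (k + 2) / 2 ^ (k + 1)"
    unfolding sum_descending by (simp add: field_simps)
  finally show "has_bochner_integral lborel
      (\<lambda>u::real. (\<integral>x. (det (sym_of k x - u \<cdot>\<^sub>m 1\<^sub>m k))\<^sup>2 \<partial>GOE k) * exp (- u\<^sup>2))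
      (sqrt pi * fact (k + 2) / 2 ^ (k + 1))"
    unfolding det_sym_of_shift_square GOE_eq_product char_poly_correlation
    by (simp add: sum_distrib_right mult.assoc)
qed

end
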